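(* Let $U$ be a random-free graphon computable in $d_\square$ (i.e. having a computable $d_\square$-name). Then $U$ is computable in $d_1$ (i.e. has a computable $d_1$-name).
   Context: A graphon is a symmetric measurable function $W\colon[0,1]^2\to[0,1]$; it is random-free if it is $\{0,1\}$-valued almost everywhere with respect to Lebesgue measure. For symmetric measurable $F\colon[0,1]^2\to[-1,1]$, $\|F\|_\square=\sup_{S,T\subseteq[0,1]}\left|\int_{S\times T}F(x,y)\,dx\,dy\right|$ (over measurable $S,T$) and $\|F\|_1=\int|F(x,y)|\,dx\,dy$. For graphons $U,W$: $d_\square(U,W)=\|U-W\|_\square$ and $d_1(U,W)=\|U-W\|_1$. Let $\mathcal{S}=(s_i)_{i\in\mathbb{N}}$ be a (straightforward) computable enumeration of the graphons that are constant with a rational value on each product $p\times q$ of parts $p,q$ of a partition of $[0,1]$ into finitely many equally-sized intervals. For $d\in\{d_1,d_\square\}$, a $d$-name of a graphon $U$ is a sequence $(s_{k_j})_{j\in\mathbb{N}}$ of elements of $\mathcal{S}$ with $d(s_{k_j},s_{k_\ell})\le2^{-j}$ for all $j<\ell$ and $d(s_{k_j},U)\to0$; it is computable if the sequence $(k_j)_j$ of natural numbers is computable. *)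

theory Defs
  imports "HOL-Analysis.Analysis"
begin

section \<open>Computable functions on the natural numbers\<close>

text \<open>Kleene's partial recursive functions: programs and their evaluation relation.\<close>

datatype recf =
    Zero
  | Succ
  | Proj nat
  | Comp recf "recf list"
  | Prec recf recf
  | Mu recf

inductive evaluates :: "recf \<Rightarrow> nat list \<Rightarrow> nat \<Rightarrow> bool" where
  evaluates_Zero: "evaluates Zero xs 0"
| evaluates_Succ: "evaluates Succ [x] (Suc x)"
| evaluates_Proj: "i < length xs \<Longrightarrow> evaluates (Proj i) xs (xs ! i)"
| evaluates_Comp: "list_all2 (\<lambda>g y. evaluates g xs y) gs ys \<Longrightarrow> evaluates f ys z \<Longrightarrow> evaluates (Comp f gs) xs z"
| evaluates_Prec_0: "evaluates f xs z \<Longrightarrow> evaluates (Prec f g) (0 # xs) z"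
| evaluates_Prec_Suc: "evaluates (Prec f g) (n # xs) y \<Longrightarrow> evaluates g (n # y # xs) z
    \<Longrightarrow> evaluates (Prec f g) (Suc n # xs) z"
| evaluates_Mu: "evaluates f (n # xs) 0 \<Longrightarrow> (\<forall>m<n. \<exists>y>0. evaluates f (m # xs) y) \<Longrightarrow> evaluates (Mu f) xs n"
monos list.rel_mono

inductive_cases evaluates_ZeroE: "evaluates Zero xs y"
inductive_cases evaluates_SuccE: "evaluates Succ xs y"
inductive_cases evaluates_ProjE: "evaluates (Proj i) xs y"
inductive_cases evaluates_CompE: "evaluates (Comp f gs) xs y"
inductive_cases evaluates_Prec_0E: "evaluates (Prec f g) (0 # xs) y"
inductive_cases evaluates_Prec_SucE: "evaluates (Prec f g) (Suc n # xs) y"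
inductive_cases evaluates_MuE: "evaluates (Mu f) xs y"

lemma evaluates_deterministic: "evaluates r xs y \<Longrightarrow> evaluates r xs z \<Longrightarrow> y = z"
proof (induction arbitrary: z rule: evaluates.induct)
  case (evaluates_Comp xs gs ys f w)
  from evaluates_Comp.prems obtain ys' where ys': "list_all2 (\<lambda>g y. evaluates g xs y) gs ys'"
    and f: "evaluates f ys' z"
    by (rule evaluates_CompE)
  have "ys = ys'"
    using evaluates_Comp.IH(1) ys' by (auto simp: list_all2_conv_all_nth intro!: nth_equalityI)
  with f evaluates_Comp.IH(2) show ?case by blast
next
  case (evaluates_Prec_Suc f g n xs y w)
  from evaluates_Prec_Suc.prems obtain y' where "evaluates (Prec f g) (n # xs) y'" "evaluates g (n # y' # xs) z"
    by (rule evaluates_Prec_SucE)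
  with evaluates_Prec_Suc.IH show ?case by blast
next
  case (evaluates_Mu f n xs)
  from evaluates_Mu.prems have z: "evaluates f (z # xs) 0" "\<forall>m<z. \<exists>y>0. evaluates f (m # xs) y"
    by (rule evaluates_MuE; simp)+
  have "\<not> z < n"
    using z(1) evaluates_Mu.IH(2) by fastforce
  moreover have "\<not> n < z"
    using z(2) evaluates_Mu.IH(1) by fastforce
  ultimately show ?case by simp
qed (blast elim: evaluates_ZeroE evaluates_SuccE evaluates_ProjE evaluates_Prec_0E)+

definition computable :: "(nat \<Rightarrow> nat) \<Rightarrow> bool" where
  "computable f \<longleftrightarrow> (\<exists>r. \<forall>x. evaluates r [x] (f x))"

definition computable3 :: "(nat \<Rightarrow> nat \<Rightarrow> nat \<Rightarrow> nat) \<Rightarrow> bool" where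
  "computable3 f \<longleftrightarrow> (\<exists>r. \<forall>x y z. evaluates r [x, y, z] (f x y z))"

section \<open>Graphons\<close>

abbreviation unit_square :: "(real \<times> real) set" where
  "unit_square \<equiv> {0..1} \<times> {0..1}"

text \<open>Functions on the unit square are represented by functions on the plane whose values
  outside the unit square are irrelevant.\<close>

definition graphon :: "(real \<times> real \<Rightarrow> real) \<Rightarrow> bool" where
  "graphon W \<longleftrightarrow>
     W \<in> borel_measurable (lebesgue_on unit_square) \<and>
     (\<forall>z\<in>unit_square. 0 \<le> W z \<and> W z \<le> 1) \<and>
     (\<forall>x\<in>{0..1}. \<forall>y\<in>{0..1}. W (x, y) = W (y, x))"

definition random_free :: "(real \<times> real \<Rightarrow> real) \<Rightarrow> bool" where
  "random_free W \<longleftrightarrow> (AE z in lebesgue_on unit_square. W z \<in> {0, 1})"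

definition cut_norm :: "(real \<times> real \<Rightarrow> real) \<Rightarrow> real" where
  "cut_norm F =
     (SUP (S, T) \<in> {(S, T). S \<in> sets lebesgue \<and> T \<in> sets lebesgue \<and> S \<subseteq> {0..1} \<and> T \<subseteq> {0..1}}.
        \<bar>LINT z:S \<times> T|lebesgue. F z\<bar>)"

definition l1_norm :: "(real \<times> real \<Rightarrow> real) \<Rightarrow> real" where
  "l1_norm F = (LINT z:unit_square|lebesgue. \<bar>F z\<bar>)"

definition d_cut :: "(real \<times> real \<Rightarrow> real) \<Rightarrow> (real \<times> real \<Rightarrow> real) \<Rightarrow> real" where
  "d_cut U W = cut_norm (\<lambda>z. U z - W z)"

definition d_one :: "(real \<times> real \<Rightarrow> real) \<Rightarrow> (real \<times> real \<Rightarrow> real) \<Rightarrow> real" where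
  "d_one U W = l1_norm (\<lambda>z. U z - W z)"

section \<open>Rational step graphons and names\<close>

text \<open>The \<open>i\<close>-th of \<open>n\<close> equally-sized intervals, for \<open>i < n\<close>: half-open on the right, except that
  the last one contains 1.\<close>

definition part :: "nat \<Rightarrow> nat \<Rightarrow> real set" where
  "part n i = {real i / real n ..< real (Suc i) / real n} \<union> (if Suc i = n then {1} else {})"

definition rational_step_graphon :: "(real \<times> real \<Rightarrow> real) \<Rightarrow> bool" where
  "rational_step_graphon W \<longleftrightarrow> graphon W \<and>
     (\<exists>n>0. \<forall>i<n. \<forall>j<n. \<exists>q\<in>\<rat>. \<forall>z \<in> part n i \<times> part n j. W z = q)"

text \<open>An enumeration is computable if the number of parts of its \<open>m\<close>-th element, and numerators
  and denominators of the values of that element, are computable from \<open>m\<close>. No specific enumeration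
  is singled out. Equality of graphons is equality on the unit square.\<close>

definition computable_enumeration :: "(nat \<Rightarrow> real \<times> real \<Rightarrow> real) \<Rightarrow> bool" where
  "computable_enumeration s \<longleftrightarrow>
     (\<forall>m. rational_step_graphon (s m)) \<and>
     (\<forall>W. rational_step_graphon W \<longrightarrow> (\<exists>m. \<forall>z\<in>unit_square. s m z = W z)) \<and>
     (\<exists>n a b. computable n \<and> computable3 a \<and> computable3 b \<and>
        (\<forall>m. n m > 0 \<and>
          (\<forall>i < n m. \<forall>j < n m. b m i j > 0 \<and>
             (\<forall>z \<in> part (n m) i \<times> part (n m) j. s m z = real (a m i j) / real (b m i j)))))"

definition is_name ::
  "((real \<times> real \<Rightarrow> real) \<Rightarrow> (real \<times> real \<Rightarrow> real) \<Rightarrow> real) \<Rightarrow>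
   (nat \<Rightarrow> real \<times> real \<Rightarrow> real) \<Rightarrow> (real \<times> real \<Rightarrow> real) \<Rightarrow> (nat \<Rightarrow> nat) \<Rightarrow> bool" where
  "is_name d s U k \<longleftrightarrow>
     (\<forall>j l. j < l \<longrightarrow> d (s (k j)) (s (k l)) \<le> 1 / 2 ^ j) \<and>
     (\<lambda>j. d (s (k j)) U) \<longlonglongrightarrow> 0"

definition computable_in ::
  "((real \<times> real \<Rightarrow> real) \<Rightarrow> (real \<times> real \<Rightarrow> real) \<Rightarrow> real) \<Rightarrow>
   (nat \<Rightarrow> real \<times> real \<Rightarrow> real) \<Rightarrow> (real \<times> real \<Rightarrow> real) \<Rightarrow> bool" where
  "computable_in d s U \<longleftrightarrow> (\<exists>k. computable k \<and> is_name d s U k)"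

end

theory Submission
  imports Defs
begin

text \<open>If \<open>U\<close> is \<open>{0,1}\<close>-valued, then \<open>\<bar>W - U\<bar> = W (1 - U) + U (1 - W)\<close> almost everywhere, which is affine
  in \<open>U\<close>: replacing \<open>U\<close> by \<open>V\<close> changes the integral by \<open>\<integral> (1 - 2 W) (V - U)\<close>, and for a step graphon \<open>W\<close>
  with \<open>n\<^sup>2\<close> blocks this is at most \<open>n\<^sup>2\<close> times the cut distance of \<open>U\<close> and \<open>V\<close>. Hence the \<open>d\<^sub>1\<close>-distance
  of \<open>U\<close> to the elements of the enumeration is computable from a \<open>d\<^sub>\<box>\<close>-name of \<open>U\<close>. As rational
  step graphons are \<open>d\<^sub>1\<close>-dense, an unbounded search for an element close to \<open>U\<close> succeeds.\<close>

section \<open>Recursive functions on lists of fixed length\<close>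

text \<open>The list is an environment of \<open>n\<close> variables, addressed by position. Fixing
  its length makes functions of any arity composable by the same rules; on lists of other lengths
  the program is unconstrained.\<close>

definition recursive_fn :: "nat \<Rightarrow> (nat list \<Rightarrow> nat) \<Rightarrow> bool" where
  "recursive_fn n f \<longleftrightarrow> (\<exists>r. \<forall>xs. length xs = n \<longrightarrow> evaluates r xs (f xs))"

named_theorems recursive_intros

lemma recursive_fn_cong:
  assumes "recursive_fn n f" "\<And>xs. length xs = n \<Longrightarrow> f xs = g xs"
  shows "recursive_fn n g"
  using assms unfolding recursive_fn_def by metis

lemma computable_iff_recursive_fn: "computable f \<longleftrightarrow> recursive_fn 1 (\<lambda>xs. f (xs ! 0))"
proof -
  have "(\<forall>xs. length xs = 1 \<longrightarrow> evaluates r xs (f (xs ! 0))) \<longleftrightarrow> (\<forall>x. evaluates r [x] (f x))" for r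
    by (auto simp: length_Suc_conv)
  then show ?thesis
    by (simp add: computable_def recursive_fn_def)
qed

lemma computable3_imp_recursive_fn:
  assumes "computable3 f"
  shows "recursive_fn 3 (\<lambda>xs. f (xs ! 0) (xs ! 1) (xs ! 2))"
proof -
  obtain r where "\<And>x y z. evaluates r [x, y, z] (f x y z)"
    using assms unfolding computable3_def by blast
  then have "\<forall>xs. length xs = 3 \<longrightarrow> evaluates r xs (f (xs ! 0) (xs ! 1) (xs ! 2))"
    by (auto simp: length_Suc_conv numeral_3_eq_3 numeral_2_eq_2)
  then show ?thesis
    unfolding recursive_fn_def by blast
qed

lemma recursive_fn_nth: "i < n \<Longrightarrow> recursive_fn n (\<lambda>xs. xs ! i)"
  unfolding recursive_fn_def by (intro exI[of _ "Proj i"]) (auto intro: evaluates_Proj)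

lemma recursive_fn_comp:
  assumes f: "recursive_fn (length gs) f" and gs: "\<And>g. g \<in> set gs \<Longrightarrow> recursive_fn n g"
  shows "recursive_fn n (\<lambda>xs. f (map (\<lambda>g. g xs) gs))"
proof -
  obtain r where r: "\<And>xs. length xs = length gs \<Longrightarrow> evaluates r xs (f xs)"
    using f unfolding recursive_fn_def by blast
  obtain q where q: "\<And>g xs. g \<in> set gs \<Longrightarrow> length xs = n \<Longrightarrow> evaluates (q g) xs (g xs)"
    using gs unfolding recursive_fn_def by metis
  have "evaluates (Comp r (map q gs)) xs (f (map (\<lambda>g. g xs) gs))" if "length xs = n" for xs
    by (rule evaluates_Comp[OF _ r]) (auto simp: list_all2_conv_all_nth q that)
  then show ?thesis
    unfolding recursive_fn_def by blast
qed

lemma recursive_fn_comp1: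
  assumes "recursive_fn 1 (\<lambda>xs. f (xs ! 0))" "recursive_fn n g"
  shows "recursive_fn n (\<lambda>xs. f (g xs))"
  using recursive_fn_comp[of "[g]" "\<lambda>xs. f (xs ! 0)" n] assms by simp

lemma recursive_fn_comp3:
  assumes "recursive_fn 3 (\<lambda>xs. f (xs ! 0) (xs ! 1) (xs ! 2))"
    and "recursive_fn n g" "recursive_fn n h" "recursive_fn n k"
  shows "recursive_fn n (\<lambda>xs. f (g xs) (h xs) (k xs))"
  using recursive_fn_comp[of "[g, h, k]" "\<lambda>xs. f (xs ! 0) (xs ! 1) (xs ! 2)" n] assms
  by (auto simp: numeral_3_eq_3)

text \<open>Binding a variable prepends it to the environment. The step function therefore sees the
  counter at position 0, the accumulated value at position 1, and the outer environment as
  \<open>tl (tl xs)\<close>.\<close>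

lemma recursive_fn_rec_nat:
  assumes c: "recursive_fn n c" and b: "recursive_fn n b"
    and g: "recursive_fn (Suc (Suc n)) (\<lambda>xs. g (xs ! 0) (tl xs ! 0) (tl (tl xs)))"
  shows "recursive_fn n (\<lambda>xs. rec_nat (c xs) (\<lambda>i y. g i y xs) (b xs))"
proof -
  obtain r where r: "\<And>xs. length xs = n \<Longrightarrow> evaluates r xs (c xs)"
    using c unfolding recursive_fn_def by blast
  obtain q where "\<And>xs. length xs = Suc (Suc n) \<Longrightarrow> evaluates q xs (g (xs ! 0) (tl xs ! 0) (tl (tl xs)))"
    using g unfolding recursive_fn_def by blast
  then have q: "evaluates q (i # y # xs) (g i y xs)" if "length xs = n" for i y xs
    using that by (metis length_Cons list.sel(3) nth_Cons_0)
  have "evaluates (Prec r q) (m # xs) (rec_nat (c xs) (\<lambda>i y. g i y xs) m)" if "length xs = n" for m xs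
    by (induction m) (auto intro: evaluates.intros r q that)
  then have prec: "recursive_fn (Suc n) (\<lambda>xs. rec_nat (c (tl xs)) (\<lambda>i y. g i y (tl xs)) (hd xs))"
    unfolding recursive_fn_def by (metis (no_types) diff_Suc_1 length_tl list.collapse length_0_conv nat.distinct(1))
  \<comment> \<open>\<open>Prec\<close> recurses on the head of its argument list, whereas here the
    bound is itself computed from the environment. Composing with \<open>b\<close> followed by all
    projections turns \<open>xs\<close> into \<open>b xs # xs\<close>.\<close>
  define ps where "ps = b # map (\<lambda>i xs. xs ! i) [0..<n]"
  have map_ps: "map (\<lambda>p. p xs) ps = b xs # xs" if "length xs = n" for xs
    using that by (auto simp: ps_def o_def intro!: nth_equalityI)
  have "recursive_fn n (\<lambda>xs. (\<lambda>xs. rec_nat (c (tl xs)) (\<lambda>i y. g i y (tl xs)) (hd xs)) (map (\<lambda>p. p xs) ps))"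
    using prec b by (intro recursive_fn_comp) (auto simp: ps_def intro: recursive_fn_nth)
  then show ?thesis
    by (rule recursive_fn_cong) (simp add: map_ps)
qed

section \<open>Closure under arithmetic, bounded sums and minimisation\<close>

lemma recursive_fn_Suc [recursive_intros]:
  assumes "recursive_fn n f"
  shows "recursive_fn n (\<lambda>xs. Suc (f xs))"
proof (rule recursive_fn_comp1[OF _ assms])
  show "recursive_fn 1 (\<lambda>xs. Suc (xs ! 0))"
    unfolding recursive_fn_def
    by (intro exI[of _ Succ]) (auto simp: length_Suc_conv intro: evaluates_Succ)
qed

lemma recursive_fn_const [recursive_intros]: "recursive_fn n (\<lambda>xs. c)"
proof (induction c)
  case 0
  show ?case
    unfolding recursive_fn_def by (intro exI[of _ Zero]) (auto intro: evaluates_Zero)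
qed (rule recursive_fn_Suc)

text \<open>Each enclosing sum or search adds one \<open>tl\<close> in front of an outer variable.
  Three suffice for the final program, which is a search over a double sum.\<close>

lemma recursive_fn_var [recursive_intros]:
  "i < n \<Longrightarrow> recursive_fn n (\<lambda>xs. xs ! i)"
  "Suc i < n \<Longrightarrow> recursive_fn n (\<lambda>xs. tl xs ! i)"
  "Suc (Suc i) < n \<Longrightarrow> recursive_fn n (\<lambda>xs. tl (tl xs) ! i)"
  "Suc (Suc (Suc i)) < n \<Longrightarrow> recursive_fn n (\<lambda>xs. tl (tl (tl xs)) ! i)"
  by (rule recursive_fn_nth, assumption)
    (rule recursive_fn_cong[OF recursive_fn_nth], assumption, simp add: nth_tl)+

lemma recursive_fn_shift2:
  assumes "recursive_fn n f"
  shows "recursive_fn (Suc (Suc n)) (\<lambda>xs. f (tl (tl xs)))"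
proof -
  define ps :: "(nat list \<Rightarrow> nat) list" where "ps = map (\<lambda>i xs. xs ! Suc (Suc i)) [0..<n]"
  have "recursive_fn (Suc (Suc n)) (\<lambda>xs. f (map (\<lambda>p. p xs) ps))"
    using assms by (intro recursive_fn_comp) (auto simp: ps_def intro: recursive_fn_nth)
  then show ?thesis
    by (rule recursive_fn_cong)
      (auto simp: ps_def length_Suc_conv intro!: arg_cong[of _ _ f] nth_equalityI)
qed

text \<open>The summand of a bounded sum depends on the index and the environment, but a recursion
  step also carries the accumulated value at position 1. This lemma inserts that extra
  argument.\<close>

lemma recursive_fn_shift_second:
  assumes "recursive_fn (Suc n) (\<lambda>xs. f (xs ! 0) (tl xs))"
  shows "recursive_fn (Suc (Suc n)) (\<lambda>xs. f (xs ! 0) (tl (tl xs)))"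
proof -
  define ps :: "(nat list \<Rightarrow> nat) list"
    where "ps = (\<lambda>xs. xs ! 0) # map (\<lambda>i xs. xs ! Suc (Suc i)) [0..<n]"
  have "recursive_fn (Suc (Suc n)) (\<lambda>xs. (\<lambda>xs. f (xs ! 0) (tl xs)) (map (\<lambda>p. p xs) ps))"
    using assms by (intro recursive_fn_comp) (auto simp: ps_def intro: recursive_fn_nth)
  then show ?thesis
    by (rule recursive_fn_cong)
      (auto simp: ps_def length_Suc_conv intro!: arg_cong[of _ _ "f _"] nth_equalityI)
qed

lemma recursive_fn_add [recursive_intros]:
  assumes "recursive_fn n f" "recursive_fn n g"
  shows "recursive_fn n (\<lambda>xs. f xs + g xs)"
proof -
  have "rec_nat (f xs) (\<lambda>i y. Suc y) m = f xs + m" for xs m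
    by (induction m) auto
  moreover have "recursive_fn n (\<lambda>xs. rec_nat (f xs) (\<lambda>i y. Suc y) (g xs))"
    using assms by (intro recursive_fn_rec_nat recursive_intros) auto
  ultimately show ?thesis
    by simp
qed

lemma recursive_fn_sum [recursive_intros]:
  assumes "recursive_fn n b" "recursive_fn (Suc n) (\<lambda>xs. f (xs ! 0) (tl xs))"
  shows "recursive_fn n (\<lambda>xs. \<Sum>i<b xs. f i xs)"
proof -
  have "rec_nat 0 (\<lambda>i y. y + f i xs) m = (\<Sum>i<m. f i xs)" for xs m
    by (induction m) auto
  moreover have "recursive_fn n (\<lambda>xs. rec_nat 0 (\<lambda>i y. y + f i xs) (b xs))"
    using assms by (intro recursive_fn_rec_nat recursive_fn_add recursive_fn_shift_second recursive_intros) auto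
  ultimately show ?thesis
    by simp
qed

lemma recursive_fn_mult [recursive_intros]:
  assumes "recursive_fn n f" "recursive_fn n g"
  shows "recursive_fn n (\<lambda>xs. f xs * g xs)"
proof -
  have "rec_nat 0 (\<lambda>i y. y + f xs) m = f xs * m" for xs m
    by (induction m) auto
  moreover have "recursive_fn n (\<lambda>xs. rec_nat 0 (\<lambda>i y. y + f xs) (g xs))"
    using assms by (intro recursive_fn_rec_nat recursive_fn_shift2 recursive_intros) auto
  ultimately show ?thesis
    by simp
qed

lemma recursive_fn_diff [recursive_intros]:
  assumes "recursive_fn n f" "recursive_fn n g"
  shows "recursive_fn n (\<lambda>xs. f xs - g xs)"
proof -
  \<comment> \<open>A recursion that returns its own counter computes the predecessor; iterating it
    \<open>g xs\<close> times gives truncated subtraction.\<close>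
  have pred: "rec_nat 0 (\<lambda>i y. i) m = m - 1" for m :: nat
    by (cases m) auto
  have "rec_nat (f xs) (\<lambda>i y. rec_nat 0 (\<lambda>i y. i) y) m = f xs - m" for xs m
    by (induction m) (auto simp: pred)
  moreover have "recursive_fn n (\<lambda>xs. rec_nat (f xs) (\<lambda>i y. rec_nat 0 (\<lambda>i y. i) y) (g xs))"
    using assms by (intro recursive_fn_rec_nat recursive_intros) auto
  ultimately show ?thesis
    by simp
qed

lemma recursive_fn_power [recursive_intros]:
  assumes "recursive_fn n f"
  shows "recursive_fn n (\<lambda>xs. c ^ f xs)"
proof -
  have "rec_nat 1 (\<lambda>i y. c * y) m = c ^ m" for m
    by (induction m) auto
  moreover have "recursive_fn n (\<lambda>xs. rec_nat 1 (\<lambda>i y. c * y) (f xs))"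
    using assms by (intro recursive_fn_rec_nat recursive_intros) auto
  ultimately show ?thesis
    by simp
qed

text \<open>The quotient counts the \<open>t < p\<close> with \<open>Suc t * q \<le> p\<close>. By
  truncated subtraction the first factor is the 0/1 indicator of that inequality; the second is the
  indicator of \<open>q > 0\<close> and yields the convention \<open>p div 0 = 0\<close>.\<close>

lemma div_eq_sum:
  fixes p q :: nat
  shows "p div q = (\<Sum>t<p. (1 - (Suc t * q - p)) * (1 - (1 - q)))"
proof (cases "q = 0")
  case False
  have "t < p div q \<longleftrightarrow> t < p \<and> Suc t * q \<le> p" for t
    using False by (metis Suc_le_eq bot_nat_0.not_eq_extremum div_le_dividend less_eq_div_iff_mult_less_eq order_less_le_trans)
  then have "{..<p div q} = {t \<in> {..<p}. Suc t * q \<le> p}"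
    by auto
  then have "p div q = (\<Sum>t \<in> {t \<in> {..<p}. Suc t * q \<le> p}. 1)"
    by (metis card_eq_sum card_lessThan)
  also have "\<dots> = (\<Sum>t<p. (1 - (Suc t * q - p)) * (1 - (1 - q)))"
    using False by (subst sum.inter_filter) (auto intro!: sum.cong simp: not_less_eq_eq)
  finally show ?thesis .
qed simp

lemma recursive_fn_div [recursive_intros]:
  assumes "recursive_fn n f" "recursive_fn n g"
  shows "recursive_fn n (\<lambda>xs. f xs div g xs)"
proof -
  define h where "h p q = p div q" for p q :: nat
  have "recursive_fn 2 (\<lambda>xs. h (xs ! 0) (xs ! 1))"
    unfolding h_def div_eq_sum by (intro recursive_intros) auto
  from recursive_fn_comp[of "[f, g]", simplified, unfolded numeral_2_eq_2[symmetric], OF this]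
  show ?thesis
    using assms by (auto simp: h_def)
qed

text \<open>\<open>Mu\<close> requires a zero, supplied by \<open>ex\<close>, and positive values at
  all smaller candidates, which is minimality of the \<open>LEAST\<close>.\<close>

lemma recursive_fn_Least [recursive_intros]:
  assumes f: "recursive_fn (Suc n) (\<lambda>xs. f (xs ! 0) (tl xs))"
    and ex: "\<And>xs. length xs = n \<Longrightarrow> \<exists>m. f m xs = 0"
  shows "recursive_fn n (\<lambda>xs. LEAST m. f m xs = 0)"
proof -
  obtain r where "\<And>xs. length xs = Suc n \<Longrightarrow> evaluates r xs (f (xs ! 0) (tl xs))"
    using f unfolding recursive_fn_def by blast
  then have r: "evaluates r (m # xs) (f m xs)" if "length xs = n" for m xs
    using that by (metis length_Cons list.sel(3) nth_Cons_0)
  have "evaluates (Mu r) xs (LEAST m. f m xs = 0)" if xs: "length xs = n" for xs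
  proof (rule evaluates_Mu)
    show "evaluates r ((LEAST m. f m xs = 0) # xs) 0"
      using r[OF xs, of "LEAST m. f m xs = 0"] LeastI_ex[OF ex[OF xs]] by simp
    show "\<forall>m<LEAST m. f m xs = 0. \<exists>y>0. evaluates r (m # xs) y"
    proof (intro allI impI)
      fix m assume "m < (LEAST m. f m xs = 0)"
      then have "f m xs > 0"
        by (blast dest: not_less_Least)
      then show "\<exists>y>0. evaluates r (m # xs) y"
        using r[OF xs] by blast
    qed
  qed
  then show ?thesis
    unfolding recursive_fn_def by blast
qed

section \<open>Step graphons and the two distances\<close>

abbreviation square_measure :: "(real \<times> real) measure" where
  "square_measure \<equiv> lebesgue_on unit_square"

lemma unit_square_lmeasurable: "unit_square \<in> lmeasurable"
  by (metis cbox_Pair_eq cbox_interval lmeasurable_cbox)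

interpretation square_measure: finite_measure square_measure
  by (rule finite_measure_lebesgue_on[OF unit_square_lmeasurable])

lemma space_square_measure: "space square_measure = unit_square"
  by (simp add: space_restrict_space)

lemma integrable_square_bounded:
  fixes f :: "real \<times> real \<Rightarrow> real"
  assumes "f \<in> borel_measurable square_measure" "\<And>z. z \<in> unit_square \<Longrightarrow> \<bar>f z\<bar> \<le> B"
  shows "integrable square_measure f"
  by (rule square_measure.integrable_const_bound[where B = B])
    (use assms in \<open>auto intro!: AE_I2 simp: space_square_measure\<close>)

text \<open>Turns integrals over varying sets into integrals against one finite measure, so that
  linearity and domination can be applied to them uniformly.\<close>

lemma set_integral_square:
  fixes F :: "real \<times> real \<Rightarrow> real"
  assumes "A \<subseteq> unit_square"
  shows "(LINT z:A|lebesgue. F z) = (LINT z|square_measure. indicator A z * F z)"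
proof -
  have [simp]: "unit_square \<in> sets lebesgue"
    using unit_square_lmeasurable by (rule fmeasurableD)
  have "(LINT z|square_measure. indicator A z * F z)
      = (LINT z|lebesgue. indicator unit_square z *\<^sub>R (indicator A z * F z))"
    by (subst integral_restrict_space) auto
  also have "\<dots> = (LINT z:A|lebesgue. F z)"
    unfolding set_lebesgue_integral_def
    using assms by (intro Bochner_Integration.integral_cong) (auto split: split_indicator)
  finally show ?thesis by simp
qed

lemma d_one_eq: "d_one U W = (LINT z|square_measure. \<bar>U z - W z\<bar>)"
  unfolding d_one_def l1_norm_def
  by (subst set_integral_square) (auto intro!: Bochner_Integration.integral_cong simp: space_square_measure)

lemma integrable_graphon_combination:
  assumes "graphon U" "graphon W"
  shows "integrable square_measure U"
    and "integrable square_measure (\<lambda>z. U z - W z)"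
    and "integrable square_measure (\<lambda>z. U z * W z)"
    and "integrable square_measure (\<lambda>z. \<bar>U z - W z\<bar>)"
proof -
  have U [measurable]: "U \<in> borel_measurable square_measure"
    and W [measurable]: "W \<in> borel_measurable square_measure"
    and bd: "\<And>z. z \<in> unit_square \<Longrightarrow> 0 \<le> U z \<and> U z \<le> 1" "\<And>z. z \<in> unit_square \<Longrightarrow> 0 \<le> W z \<and> W z \<le> 1"
    using assms unfolding graphon_def by blast+
  have pt: "\<bar>U z\<bar> \<le> 1" "\<bar>U z - W z\<bar> \<le> 1" "\<bar>U z * W z\<bar> \<le> 1" "\<bar>\<bar>U z - W z\<bar>\<bar> \<le> 1"
    if "z \<in> unit_square" for z
    using bd(1)[OF that] bd(2)[OF that] by (auto simp: abs_mult mult_le_one abs_le_iff)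
  show "integrable square_measure U" "integrable square_measure (\<lambda>z. U z - W z)"
    "integrable square_measure (\<lambda>z. U z * W z)" "integrable square_measure (\<lambda>z. \<bar>U z - W z\<bar>)"
    by (rule integrable_square_bounded[where B = 1], measurable, use pt in blast)+
qed

lemma integral_rectangle_le_d_cut:
  assumes U: "graphon U" and W: "graphon W"
    and S: "S \<in> sets lebesgue" "S \<subseteq> {0..1}" and T: "T \<in> sets lebesgue" "T \<subseteq> {0..1}"
  shows "\<bar>LINT z|square_measure. indicator (S \<times> T) z * (U z - W z)\<bar> \<le> d_cut U W"
proof -
  let ?R = "{(S, T). S \<in> sets lebesgue \<and> T \<in> sets lebesgue \<and> S \<subseteq> {0..1::real} \<and> T \<subseteq> {0..1::real}}"
  let ?I = "\<lambda>(S, T). \<bar>LINT z:S \<times> T|lebesgue. U z - W z\<bar>"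
  have eq: "?I (S, T) = \<bar>LINT z|square_measure. indicator (S \<times> T) z * (U z - W z)\<bar>"
    if "(S, T) \<in> ?R" for S T
    using that by (auto simp: set_integral_square[of "S \<times> T"] subset_iff)
  \<comment> \<open>A supremum of reals dominates the members of the family only when the family is
    bounded above; the integral of \<open>\<bar>U z - W z\<bar>\<close> is a bound.\<close>
  have "bdd_above (?I ` ?R)"
  proof (rule bdd_aboveI2)
    fix p assume "p \<in> ?R"
    then obtain S T where p: "p = (S, T)" "(S, T) \<in> ?R"
      by blast
    have "?I p = \<bar>LINT z|square_measure. indicator (S \<times> T) z * (U z - W z)\<bar>"
      using eq p by simp
    also have "\<dots> \<le> (LINT z|square_measure. \<bar>indicator (S \<times> T) z * (U z - W z)\<bar>)"
      by (rule integral_abs_bound)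
    also have "\<dots> \<le> (LINT z|square_measure. \<bar>U z - W z\<bar>)"
      by (rule integral_mono'[OF integrable_graphon_combination(4)[OF U W]])
        (auto split: split_indicator)
    finally show "?I p \<le> (LINT z|square_measure. \<bar>U z - W z\<bar>)" .
  qed
  then have "?I (S, T) \<le> (SUP p \<in> ?R. ?I p)"
    using S T by (intro cSUP_upper) auto
  then show ?thesis
    using eq[of S T] S T by (simp add: d_cut_def cut_norm_def)
qed

section \<open>Partitions into equal intervals and their refinements\<close>

text \<open>The index of the interval is an explicit function of \<open>x\<close>, which makes
  disjointness and covering immediate. The cap \<open>n - 1\<close> matters only at
  \<open>x = 1\<close>, where the floor would give \<open>n\<close>.\<close>

lemma part_iff:
  assumes "i < n"
  shows "x \<in> part n i \<longleftrightarrow> x \<in> {0..1} \<and> i = min (n - 1) (nat \<lfloor>real n * x\<rfloor>)"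
proof -
  have n: "0 < real n"
    using assms by simp
  show ?thesis
  proof (cases "x = 1")
    case True
    have "\<not> 1 < real (Suc i) / real n" if "Suc i \<noteq> n"
      using n assms that by (simp add: field_simps)
    moreover have "real i / real n \<le> 1"
      using n assms by (simp add: field_simps)
    ultimately show ?thesis
      using True n assms by (auto simp: part_def)
  next
    case False
    have "x \<in> part n i \<longleftrightarrow> real i \<le> real n * x \<and> real n * x < real (Suc i)"
      using n False by (auto simp: part_def field_simps)
    also have "\<dots> \<longleftrightarrow> \<lfloor>real n * x\<rfloor> = int i"
      by (auto simp: floor_eq_iff)
    also have "\<dots> \<longleftrightarrow> x \<in> {0..1} \<and> i = min (n - 1) (nat \<lfloor>real n * x\<rfloor>)"
    proof
      assume i: "\<lfloor>real n * x\<rfloor> = int i"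
      then have "real i \<le> real n * x" "real n * x < real i + 1"
        by (auto simp: floor_eq_iff)
      moreover have "real i + 1 \<le> real n"
        using assms by simp
      ultimately have "0 \<le> real n * x" "real n * x < real n * 1"
        by linarith+
      then have "0 \<le> x" "x < 1"
        using n by (simp_all add: zero_le_mult_iff)
      then show "x \<in> {0..1} \<and> i = min (n - 1) (nat \<lfloor>real n * x\<rfloor>)"
        using i assms by simp
    next
      assume *: "x \<in> {0..1} \<and> i = min (n - 1) (nat \<lfloor>real n * x\<rfloor>)"
      then have "0 \<le> real n * x" "real n * x < real n"
        using n False by auto
      then have "0 \<le> \<lfloor>real n * x\<rfloor>" "\<lfloor>real n * x\<rfloor> < int n"
        by (auto simp: floor_less_iff)
      then show "\<lfloor>real n * x\<rfloor> = int i"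
        using * by auto
    qed
    finally show ?thesis .
  qed
qed

lemma part_subset: "i < n \<Longrightarrow> part n i \<subseteq> {0..1}"
  by (auto simp: part_iff)

lemma part_disjoint: "i < n \<Longrightarrow> j < n \<Longrightarrow> x \<in> part n i \<Longrightarrow> x \<in> part n j \<Longrightarrow> i = j"
  by (metis part_iff)

lemma part_cover: "n > 0 \<Longrightarrow> x \<in> {0..1} \<Longrightarrow> \<exists>i<n. x \<in> part n i"
  by (intro exI[of _ "min (n - 1) (nat \<lfloor>real n * x\<rfloor>)"]) (auto simp: part_iff)

text \<open>Each of the \<open>n\<close> intervals splits into \<open>N\<close> consecutive ones, so
  the coarse index is the quotient by \<open>N\<close>. This lets two step graphons with different
  grids be evaluated on a common one.\<close>

lemma part_refine:
  assumes "i < n * N" "x \<in> part (n * N) i"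
  shows "x \<in> part n (i div N)"
proof -
  have N: "N > 0" and n: "n > 0"
    using assms(1) by (auto intro: Nat.gr0I)
  have i: "i div N * N \<le> i" "Suc i \<le> Suc (i div N) * N"
    using N by (auto simp: dividend_less_div_times Suc_leI)
  have lo: "real (i div N) / real n \<le> real i / real (n * N)"
  proof -
    have "real (i div N * N) \<le> real i"
      using i(1) of_nat_le_iff by blast
    then show ?thesis
      using N n by (simp add: field_simps)
  qed
  have hi: "real (Suc i) / real (n * N) \<le> real (Suc (i div N)) / real n"
  proof -
    have "real (Suc i) \<le> real (Suc (i div N) * N)"
      using i(2) of_nat_le_iff by blast
    then have "real (Suc i) / real (n * N) \<le> real (Suc (i div N) * N) / real (n * N)"
      by (rule divide_right_mono) simp
    also have "\<dots> = real (Suc (i div N)) / real n"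
      using N by (simp only: of_nat_mult) simp
    finally show ?thesis .
  qed
  \<comment> \<open>The extra point 1 of the last fine interval must lie in the last coarse
    interval.\<close>
  have "Suc (i div N) = n" if "Suc i = n * N"
  proof -
    have "i div N < n"
      using assms(1) by (simp add: less_mult_imp_div_less)
    moreover have "n * N \<le> Suc (i div N) * N"
      using i(2) that by simp
    ultimately show ?thesis
      using N by (metis Suc_leI mult_le_cancel2 order_antisym)
  qed
  then show ?thesis
    using assms(2) lo hi unfolding part_def by (auto split: if_splits)
qed

lemma part_borel [measurable]: "part n i \<in> sets borel"
  by (simp add: part_def)

lemma measure_part:
  assumes "i < n"
  shows "emeasure lborel (part n i) = ennreal (1 / real n)"
proof -
  have "part n i = {real i / real n ..< real (Suc i) / real n} \<union> (if Suc i = n then {1} else {})"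
    by (simp add: part_def)
  also have "emeasure lborel \<dots> = emeasure lborel {real i / real n ..< real (Suc i) / real n}"
    by (rule emeasure_Un_null_set) (auto intro: finite_imp_null_set_lborel)
  also have "\<dots> = ennreal (real (Suc i) / real n - real i / real n)"
    by (intro emeasure_lborel_Ico divide_right_mono) auto
  also have "\<dots> = ennreal (1 / real n)"
    by (simp add: diff_divide_distrib[symmetric])
  finally show ?thesis .
qed

section \<open>Blocks and integrals of step functions\<close>

definition block :: "nat \<Rightarrow> nat \<Rightarrow> nat \<Rightarrow> (real \<times> real) set" where
  "block n i j = part n i \<times> part n j"

lemma block_borel [measurable]: "block n i j \<in> sets borel"
  unfolding block_def by (simp flip: borel_prod)

lemma block_lebesgue [measurable]: "indicator (block n i j) \<in> borel_measurable square_measure"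
  by (intro measurable_restrict_space1 measurable_completion) simp

lemma block_subset: "i < n \<Longrightarrow> j < n \<Longrightarrow> block n i j \<subseteq> unit_square"
  using part_subset unfolding block_def by blast

lemma block_nonempty:
  assumes "i < n" "j < n"
  obtains z where "z \<in> block n i j"
proof -
  have "part n i \<noteq> {}" if "i < n" for i
    using measure_part[OF that] that by auto
  then show ?thesis
    using that assms unfolding block_def by blast
qed

lemma block_refine:
  assumes "i < n * N" "j < n * N" "z \<in> block (n * N) i j"
  shows "z \<in> block n (i div N) (j div N)"
  using assms part_refine unfolding block_def by blast

lemma integral_block:
  assumes "i < n" "j < n"
  shows "(LINT z|square_measure. indicator (block n i j) z) = 1 / (real n)\<^sup>2"
proof -
  have "(LINT z|square_measure. indicator (block n i j) z) = (LINT z:block n i j|lebesgue. (1::real))"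
    using block_subset[OF assms] by (simp add: set_integral_square)
  also have "\<dots> = measure lebesgue (block n i j)"
    unfolding set_lebesgue_integral_def by simp
  also have "\<dots> = measure (lborel \<Otimes>\<^sub>M lborel) (part n i \<times> part n j)"
    by (simp add: measure_completion lborel_prod flip: block_def)
  also have "\<dots> = 1 / real n * (1 / real n)"
    unfolding measure_def using assms
    by (subst lborel.emeasure_pair_measure_Times) (simp_all add: measure_part flip: ennreal_mult)
  finally show ?thesis
    by (simp add: power2_eq_square)
qed

lemma sum_block_indicator:
  fixes c :: "nat \<Rightarrow> nat \<Rightarrow> real"
  assumes "i < n" "j < n" "z \<in> block n i j"
  shows "(\<Sum>i<n. \<Sum>j<n. indicator (block n i j) z * c i j) = c i j"
proof -
  have "(\<Sum>i'<n. \<Sum>j'<n. indicator (block n i' j') z * c i' j')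
      = (\<Sum>i'<n. \<Sum>j'<n. if j = j' then if i = i' then c i j else 0 else 0)"
  proof (intro sum.cong refl)
    fix i' j' assume "i' \<in> {..<n}" "j' \<in> {..<n}"
    then have "z \<in> block n i' j' \<longleftrightarrow> i = i' \<and> j = j'"
      using assms part_disjoint by (fastforce simp: block_def)
    then show "indicator (block n i' j') z * c i' j' = (if j = j' then if i = i' then c i j else 0 else 0)"
      by (auto simp: indicator_def)
  qed
  also have "\<dots> = c i j"
    using assms by simp
  finally show ?thesis .
qed

lemma block_cover:
  assumes "n > 0" "z \<in> unit_square"
  obtains i j where "i < n" "j < n" "z \<in> block n i j"
  using assms part_cover[of n "fst z"] part_cover[of n "snd z"] by (auto simp: block_def mem_Times_iff)

text \<open>Reduces the integral against a step function to integrals of \<open>f\<close> over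
  rectangles, which are the quantities that the cut norm controls.\<close>

lemma integral_step_mult:
  fixes f g :: "real \<times> real \<Rightarrow> real"
  assumes n: "n > 0" and f: "integrable square_measure f"
    and g: "\<And>i j z. i < n \<Longrightarrow> j < n \<Longrightarrow> z \<in> block n i j \<Longrightarrow> g z = c i j"
  shows "(LINT z|square_measure. g z * f z)
    = (\<Sum>i<n. \<Sum>j<n. c i j * (LINT z|square_measure. indicator (block n i j) z * f z))"
proof -
  have int: "integrable square_measure (\<lambda>z. indicator (block n i j) z * f z)" for i j
    by (rule Bochner_Integration.integrable_bound[OF f])
      (use f in \<open>auto split: split_indicator intro!: borel_measurable_times block_lebesgue\<close>)
  have "(LINT z|square_measure. g z * f z)
      = (LINT z|square_measure. (\<Sum>i<n. \<Sum>j<n. c i j * (indicator (block n i j) z * f z)))"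
  proof (rule Bochner_Integration.integral_cong[OF refl])
    fix z assume "z \<in> space square_measure"
    then obtain i j where ij: "i < n" "j < n" "z \<in> block n i j"
      using block_cover[OF n, of z] by (auto simp: space_square_measure)
    show "g z * f z = (\<Sum>i<n. \<Sum>j<n. c i j * (indicator (block n i j) z * f z))"
      using sum_block_indicator[OF ij, of "\<lambda>i j. c i j * f z"] g[OF ij] by (simp add: mult_ac)
  qed
  also have "\<dots> = (\<Sum>i<n. \<Sum>j<n. c i j * (LINT z|square_measure. indicator (block n i j) z * f z))"
    using int by simp
  finally show ?thesis .
qed

lemma integral_step:
  fixes g :: "real \<times> real \<Rightarrow> real"
  assumes n: "n > 0"
    and g: "\<And>i j z. i < n \<Longrightarrow> j < n \<Longrightarrow> z \<in> block n i j \<Longrightarrow> g z = c i j"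
  shows "(LINT z|square_measure. g z) = (\<Sum>i<n. \<Sum>j<n. c i j) / (real n)\<^sup>2"
proof -
  have "(LINT z|square_measure. g z * 1)
      = (\<Sum>i<n. \<Sum>j<n. c i j * (LINT z|square_measure. indicator (block n i j) z * 1))"
    using assms by (intro integral_step_mult) auto
  also have "\<dots> = (\<Sum>i<n. \<Sum>j<n. c i j * (1 / (real n)\<^sup>2))"
    by (intro sum.cong refl) (simp only: mult_1_right integral_block lessThan_iff)
  finally show ?thesis
    by (simp add: sum_divide_distrib)
qed

section \<open>The distance to a random-free graphon\<close>

lemma graphon_bounds: "graphon W \<Longrightarrow> z \<in> unit_square \<Longrightarrow> 0 \<le> W z \<and> W z \<le> 1"
  unfolding graphon_def by blast

text \<open>For \<open>0 \<le> w \<le> 1\<close>, both \<open>\<bar>w - u\<bar>\<close> and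
  \<open>w + u - 2 * (w * u)\<close> equal \<open>w\<close> at \<open>u = 0\<close> and
  \<open>1 - w\<close> at \<open>u = 1\<close>. All use of random-freeness goes through this
  identity.\<close>

lemma d_one_random_free:
  assumes W: "graphon W" and U: "graphon U" and rf: "random_free U"
  shows "d_one W U = (LINT z|square_measure. W z + U z - 2 * (W z * U z))"
  unfolding d_one_eq
proof (rule integral_cong_AE)
  show "AE z in square_measure. \<bar>W z - U z\<bar> = W z + U z - 2 * (W z * U z)"
    using rf AE_space unfolding random_free_def
    by eventually_elim (use graphon_bounds[OF W] in \<open>auto simp: space_square_measure\<close>)
qed (use W U in \<open>auto simp: graphon_def\<close>)

lemma d_one_triangle:
  assumes "graphon U" "graphon V" "graphon W"
  shows "d_one U W \<le> d_one U V + d_one V W"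
  unfolding d_one_eq using assms
  by (subst Bochner_Integration.integral_add[symmetric])
    (auto intro!: integral_mono integrable_graphon_combination Bochner_Integration.integrable_add)

lemma d_one_commute: "d_one U W = d_one W U"
  by (simp add: d_one_eq abs_minus_commute)

lemma d_one_nonneg: "0 \<le> d_one U W"
  by (simp add: d_one_eq)

lemma part_lebesgue: "part n i \<in> sets lebesgue"
  by (simp add: sets_completionI_sets)

text \<open>The integral of \<open>V j - U\<close> over a block splits into those of
  \<open>V j - V l\<close> and \<open>V l - U\<close>. For \<open>l > j\<close> the first is at most
  \<open>1 / 2 ^ j\<close>, and the second vanishes as \<open>l\<close> grows. Working on a single
  block needs only additivity of the integral.\<close>

lemma block_integral_limit:
  assumes V: "\<And>j. graphon (V j)" and U: "graphon U"
    and cauchy: "\<And>j l. j < l \<Longrightarrow> d_cut (V j) (V l) \<le> 1 / 2 ^ j"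
    and lim: "(\<lambda>j. d_cut (V j) U) \<longlonglongrightarrow> 0"
    and i: "i < n" "i' < n"
  shows "\<bar>LINT z|square_measure. indicator (block n i i') z * (V j z - U z)\<bar> \<le> 1 / 2 ^ j"
proof -
  let ?I = "\<lambda>f. LINT z|square_measure. indicator (block n i i') z * f z"
  have int: "integrable square_measure (\<lambda>z. indicator (block n i i') z * (F z - G z))"
    if "graphon F" "graphon G" for F G
    by (rule Bochner_Integration.integrable_bound[OF integrable_graphon_combination(2)[OF that]])
      (use integrable_graphon_combination(2)[OF that] in
        \<open>auto split: split_indicator intro!: borel_measurable_times block_lebesgue\<close>)
  have cut: "\<bar>?I (\<lambda>z. F z - G z)\<bar> \<le> d_cut F G" if "graphon F" "graphon G" for F G
    unfolding block_def
    by (intro integral_rectangle_le_d_cut that part_lebesgue part_subset i)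
  have "\<forall>\<^sub>F l in sequentially. \<bar>?I (\<lambda>z. V j z - U z)\<bar> \<le> 1 / 2 ^ j + d_cut (V l) U"
    using eventually_gt_at_top[of j]
  proof eventually_elim
    case (elim l)
    have "?I (\<lambda>z. V j z - U z) = ?I (\<lambda>z. V j z - V l z) + ?I (\<lambda>z. V l z - U z)"
      using V U int by (subst Bochner_Integration.integral_add[symmetric]) (auto simp: algebra_simps)
    then show ?case
      using cut[OF V[of j] V[of l]] cut[OF V[of l] U] cauchy[OF elim] by linarith
  qed
  then have "\<bar>?I (\<lambda>z. V j z - U z)\<bar> \<le> 1 / 2 ^ j + 0"
    by (intro tendsto_le[OF _ tendsto_add[OF tendsto_const lim] tendsto_const]) auto
  then show ?thesis by simp
qed

lemma d_one_approx:
  assumes W: "graphon W" and V: "graphon V" and U: "graphon U" and rf: "random_free U"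
    and n: "n > 0" and step: "\<And>i j z. i < n \<Longrightarrow> j < n \<Longrightarrow> z \<in> block n i j \<Longrightarrow> W z = c i j"
    and small: "\<And>i j. i < n \<Longrightarrow> j < n \<Longrightarrow>
      \<bar>LINT z|square_measure. indicator (block n i j) z * (V z - U z)\<bar> \<le> \<delta>"
  shows "\<bar>(LINT z|square_measure. W z * (1 - V z) + V z * (1 - W z)) - d_one W U\<bar> \<le> (real n)\<^sup>2 * \<delta>"
proof -
  note int = integrable_graphon_combination
  have int2: "integrable square_measure (\<lambda>z. F z + G z - 2 * (F z * G z))" if "graphon F" "graphon G" for F G
    using that by (intro Bochner_Integration.integrable_diff Bochner_Integration.integrable_add
        integrable_mult_right int)
  have "(LINT z|square_measure. W z * (1 - V z) + V z * (1 - W z)) - d_one W U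
      = (LINT z|square_measure. W z + V z - 2 * (W z * V z)) - (LINT z|square_measure. W z + U z - 2 * (W z * U z))"
    unfolding d_one_random_free[OF W U rf] by (simp add: algebra_simps)
  \<comment> \<open>The terms free of \<open>V\<close> and \<open>U\<close> cancel because the
    integrand is affine in the second graphon. \<open>V\<close> itself may take any values in
    [0,1].\<close>
  also have "\<dots> = (LINT z|square_measure. (1 - 2 * W z) * (V z - U z))"
    by (subst Bochner_Integration.integral_diff[symmetric])
      (rule int2[OF W V], rule int2[OF W U], simp add: algebra_simps)
  also have "\<dots> = (\<Sum>i<n. \<Sum>j<n. (1 - 2 * c i j) * (LINT z|square_measure. indicator (block n i j) z * (V z - U z)))"
    using step by (intro integral_step_mult n int V U) auto
  also have "\<bar>\<dots>\<bar> \<le> (\<Sum>i<n. \<Sum>j<n. \<delta>)"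
  proof (intro sum_abs[THEN order_trans] sum_mono)
    fix i j assume "i \<in> {..<n}" "j \<in> {..<n}"
    then have ij: "i < n" "j < n"
      by auto
    \<comment> \<open>A point of the block is needed to transfer the bounds
      \<open>0 \<le> W z \<le> 1\<close> to the constant \<open>c i j\<close>.\<close>
    obtain z where z: "z \<in> block n i j"
      using block_nonempty[OF ij] .
    then have "\<bar>1 - 2 * c i j\<bar> \<le> 1"
      using graphon_bounds[OF W] block_subset[OF ij] step[OF ij z] by fastforce
    then have "\<bar>1 - 2 * c i j\<bar> * \<bar>LINT z|square_measure. indicator (block n i j) z * (V z - U z)\<bar> \<le> 1 * \<delta>"
      using small[OF ij] by (intro mult_mono) auto
    then show "\<bar>(1 - 2 * c i j) * (LINT z|square_measure. indicator (block n i j) z * (V z - U z))\<bar> \<le> \<delta>"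
      by (simp add: abs_mult)
  qed
  also have "\<dots> = (real n)\<^sup>2 * \<delta>"
    by (simp add: power2_eq_square)
  finally show ?thesis .
qed

section \<open>Density of rational step graphons in \<open>d_one\<close>\<close>

lemma integral_le_bound_on_square:
  fixes f :: "real \<times> real \<Rightarrow> real"
  assumes "\<And>z. z \<in> unit_square \<Longrightarrow> f z \<le> e" "0 \<le> e"
  shows "(LINT z|square_measure. f z) \<le> e"
proof -
  have "measure square_measure (space square_measure) = 1"
    using integral_step[of 1 "\<lambda>z. 1" "\<lambda>i j. 1"] by simp
  moreover have "(LINT z|square_measure. f z) \<le> (LINT z|square_measure. e)"
    using assms by (intro integral_mono') (auto simp: space_square_measure)
  ultimately show ?thesis
    by simp
qed

text \<open>A measurable function is the limit of continuous functions off a negligible set. These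
  are turned into graphons, and dominated convergence with bound 1 gives convergence in
  \<open>d_one\<close>.\<close>

lemma continuous_graphon_dense:
  assumes U: "graphon U" and e: "e > 0"
  obtains G where "graphon G" "continuous_on UNIV G" "d_one G U < e"
proof -
  have Um: "U \<in> borel_measurable square_measure"
    using U by (simp add: graphon_def)
  have sq: "unit_square \<in> sets lebesgue"
    using unit_square_lmeasurable by (rule fmeasurableD)
  have "U measurable_on unit_square"
    using Um measurable_on_iff_borel_measurable[OF sq] by blast
  then obtain N g where N: "negligible N" and g: "\<And>n::nat. continuous_on UNIV (g n)"
    and lim: "\<And>z. z \<notin> N \<Longrightarrow> (\<lambda>n. g n z) \<longlonglongrightarrow> (if z \<in> unit_square then U z else 0)"
    unfolding measurable_on_def by blast
  \<comment> \<open>Averaging with the swapped argument gives symmetry and clamping gives values in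
    [0,1]; both operations are continuous and leave the limit \<open>U z\<close> unchanged.\<close>
  define G where "G n z = max 0 (min 1 ((g n z + g n (prod.swap z)) / 2))" for n z
  have cont: "continuous_on UNIV (G n)" for n
    unfolding G_def
    by (intro continuous_intros continuous_on_compose2[OF g] continuous_on_swap) (auto intro: g)
  have G: "graphon (G n)" for n
  proof -
    have "G n \<in> borel_measurable square_measure"
      by (intro continuous_imp_measurable_on_sets_lebesgue[OF _ sq] continuous_on_subset[OF cont]) auto
    then show ?thesis
      by (auto simp: graphon_def G_def add.commute)
  qed
  \<comment> \<open>\<open>G n z\<close> reads \<open>g n\<close> also at the reflected point, so
    the reflection of the exceptional set has to be discarded too.\<close>
  have "negligible (prod.swap ` N)"
  proof (rule negligible_differentiable_image_negligible[OF order_refl N])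
    have "bounded_linear (\<lambda>z::real \<times> real. (snd z, fst z))"
      by (rule bounded_linear_Pair[OF bounded_linear_snd bounded_linear_fst])
    moreover have "prod.swap = (\<lambda>z::real \<times> real. (snd z, fst z))"
      by (auto simp: fun_eq_iff)
    ultimately show "prod.swap differentiable_on N"
      by (metis bounded_linear_imp_differentiable_on)
  qed
  then have null: "N \<union> prod.swap ` N \<in> null_sets lebesgue"
    using N by (simp flip: negligible_iff_null_sets)
  have "AE z in square_measure. (\<lambda>n. \<bar>G n z - U z\<bar>) \<longlonglongrightarrow> 0"
  proof (subst AE_restrict_space_iff)
    show "AE z in lebesgue. z \<in> unit_square \<longrightarrow> (\<lambda>n. \<bar>G n z - U z\<bar>) \<longlonglongrightarrow> 0"
      using AE_not_in[OF null]
    proof eventually_elim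
      case (elim z)
      show ?case
      proof
        assume z: "z \<in> unit_square"
        have swap: "prod.swap z \<in> unit_square" "U (prod.swap z) = U z" "prod.swap z \<notin> N"
          using z U elim by (auto simp: graphon_def prod.swap_def image_iff split: prod.splits)
        have "(\<lambda>n. G n z) \<longlonglongrightarrow> max 0 (min 1 ((U z + U z) / 2))"
          unfolding G_def using lim[of z] lim[of "prod.swap z"] elim swap z
          by (intro tendsto_intros) auto
        moreover have "max 0 (min 1 ((U z + U z) / 2)) = U z"
          using graphon_bounds[OF U z] by auto
        ultimately show "(\<lambda>n. \<bar>G n z - U z\<bar>) \<longlonglongrightarrow> 0"
          by (metis LIM_zero tendsto_rabs_zero)
      qed
    qed
  qed (use sq in auto)
  then have "(\<lambda>n. LINT z|square_measure. \<bar>G n z - U z\<bar>) \<longlonglongrightarrow> (LINT z|square_measure. 0)"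
  proof (rule integral_dominated_convergence[where w = "\<lambda>z. 1", rotated 3])
    have "norm \<bar>G n z - U z\<bar> \<le> 1" if "z \<in> unit_square" for n z
      using graphon_bounds[OF U that] graphon_bounds[OF G that, of n] by auto
    then show "AE z in square_measure. norm \<bar>G n z - U z\<bar> \<le> 1" for n
      by (intro AE_I2) (simp only: space_square_measure)
    show "(\<lambda>z. \<bar>G n z - U z\<bar>) \<in> borel_measurable square_measure" for n
      using integrable_graphon_combination(4)[OF G U] by (rule borel_measurable_integrable)
  qed auto
  then have "(\<lambda>n. d_one (G n) U) \<longlonglongrightarrow> 0"
    by (simp add: d_one_eq)
  then have "\<forall>\<^sub>F n in sequentially. d_one (G n) U < e"
    using e by (rule order_tendstoD)
  then show ?thesis
    using that G cont by (meson eventually_happens' sequentially_bot)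
qed

text \<open>A continuous graphon is sampled at the lower left corner of each block and rounded down
  to a multiple of \<open>1 / n\<close>. Uniform continuity bounds the sampling error by
  \<open>e / 4\<close>, the rounding costs at most another \<open>e / 4\<close>, and
  \<open>G\<close> itself is within \<open>e / 2\<close> of \<open>U\<close>.\<close>

lemma rational_step_graphon_dense:
  assumes U: "graphon U" and e: "e > 0"
  obtains W where "rational_step_graphon W" "d_one W U < e"
proof -
  obtain G where G: "graphon G" and cont: "continuous_on UNIV G" and GU: "d_one G U < e / 2"
    using continuous_graphon_dense[OF U, of "e / 2"] e by auto
  have "compact unit_square"
    by (intro compact_Times) auto
  then have "uniformly_continuous_on unit_square G"
    using cont by (intro compact_uniformly_continuous continuous_on_subset[OF cont]) auto
  then obtain d where d: "d > 0"
    and uc: "\<And>z z'. z \<in> unit_square \<Longrightarrow> z' \<in> unit_square \<Longrightarrow> dist z' z < d \<Longrightarrow> dist (G z') (G z) < e / 4"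
    using e unfolding uniformly_continuous_on_def by (metis zero_less_divide_iff zero_less_numeral)
  \<comment> \<open>The bound \<open>d / 2\<close> serves both coordinates: a point of a block
    differs from its corner by at most \<open>1 / n\<close> in each. The bound \<open>e / 4\<close>
    is for the rounding.\<close>
  obtain n where n: "n > 0" "1 / real n < min (d / 2) (e / 4)"
    using real_arch_inverse[of "min (d / 2) (e / 4)"] d e by (auto simp: inverse_eq_divide)
  then have n0: "n > 0" and nd: "2 / real n < d" and ne: "1 / real n < e / 4"
    by (auto simp: field_simps)
  define c where "c i j = of_int \<lfloor>real n * G (real i / real n, real j / real n)\<rfloor> / real n" for i j
  define W where "W z = (\<Sum>i<n. \<Sum>j<n. indicator (block n i j) z * c i j)" for z
  have step: "W z = c i j" if "i < n" "j < n" "z \<in> block n i j" for i j z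
    unfolding W_def by (rule sum_block_indicator[OF that])
  have corner: "(real i / real n, real j / real n) \<in> unit_square" if "i < n" "j < n" for i j
    using that by (auto simp: field_simps)
  have cG: "c i j \<le> G (real i / real n, real j / real n)"
    "G (real i / real n, real j / real n) - 1 / real n < c i j" for i j
  proof -
    let ?g = "G (real i / real n, real j / real n)"
    have "of_int \<lfloor>real n * ?g\<rfloor> \<le> real n * ?g" "real n * ?g - 1 < of_int \<lfloor>real n * ?g\<rfloor>"
      by linarith+
    then have "of_int \<lfloor>real n * ?g\<rfloor> / real n \<le> real n * ?g / real n"
      "(real n * ?g - 1) / real n < of_int \<lfloor>real n * ?g\<rfloor> / real n"
      using n0 by (intro divide_right_mono divide_strict_right_mono; simp)+
    then show "c i j \<le> ?g" "?g - 1 / real n < c i j"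
      using n0 unfolding c_def by (simp_all add: diff_divide_distrib)
  qed
  have c: "0 \<le> c i j" "c i j \<le> 1" "c i j = c j i" if "i < n" "j < n" for i j
  proof -
    show "0 \<le> c i j"
      using graphon_bounds[OF G corner[OF that]] by (simp add: c_def)
    show "c i j \<le> 1"
      using graphon_bounds[OF G corner[OF that]] cG(1)[of i j] by linarith
    show "c i j = c j i"
      using G corner[OF that] by (simp add: c_def graphon_def)
  qed
  have "graphon W"
    unfolding graphon_def
  proof (intro conjI ballI)
    show "W \<in> borel_measurable square_measure"
      unfolding W_def by measurable
    show "0 \<le> W z" "W z \<le> 1" if "z \<in> unit_square" for z
      using block_cover[OF n0 that] step c by metis+
    show "W (x, y) = W (y, x)" if xy: "x \<in> {0..1}" "y \<in> {0..1}" for x y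
    proof -
      obtain i j where ij: "i < n" "j < n" "(x, y) \<in> block n i j"
        using block_cover[OF n0, of "(x, y)"] xy by blast
      then have "(y, x) \<in> block n j i"
        by (auto simp: block_def)
      then show ?thesis
        using ij step c(3) by metis
    qed
  qed
  moreover have "\<forall>i<n. \<forall>j<n. \<exists>q\<in>\<rat>. \<forall>z\<in>part n i \<times> part n j. W z = q"
  proof (intro allI impI)
    fix i j assume ij: "i < n" "j < n"
    have "c i j \<in> \<rat>"
      unfolding c_def by (intro Rats_divide) auto
    then show "\<exists>q\<in>\<rat>. \<forall>z\<in>part n i \<times> part n j. W z = q"
      using step[OF ij] unfolding block_def by blast
  qed
  ultimately have rs: "rational_step_graphon W"
    using n0 unfolding rational_step_graphon_def by blast
  have "\<bar>W z - G z\<bar> \<le> e / 2" if z: "z \<in> unit_square" for z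
  proof -
    obtain i j where ij: "i < n" "j < n" "z \<in> block n i j"
      using block_cover[OF n0 z] by blast
    have near: "\<bar>real i / real n - x\<bar> \<le> 1 / real n" if "x \<in> part n i" "i < n" for x i
    proof -
      have "real i / real n \<le> x" "x \<le> real (Suc i) / real n"
        using that by (auto simp: part_def split: if_splits)
      moreover have "real (Suc i) / real n = real i / real n + 1 / real n"
        by (simp add: add_divide_distrib)
      ultimately show ?thesis
        by linarith
    qed
    have "dist (real i / real n, real j / real n) z
        \<le> \<bar>real i / real n - fst z\<bar> + \<bar>real j / real n - snd z\<bar>"
      using sqrt_sum_squares_le_sum_abs[of "real i / real n - fst z" "real j / real n - snd z"]
      by (simp add: dist_prod_def dist_real_def)
    also have "\<dots> \<le> 2 / real n"
      using near[of "fst z" i] near[of "snd z" j] ij by (auto simp: block_def)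
    also have "\<dots> < d"
      by (rule nd)
    finally have "\<bar>G (real i / real n, real j / real n) - G z\<bar> < e / 4"
      using uc[OF z corner[OF ij(1,2)]] by (simp add: dist_real_def)
    then show ?thesis
      using cG[of i j] step[OF ij] ne by linarith
  qed
  then have "d_one W G \<le> e / 2"
    unfolding d_one_eq using e by (intro integral_le_bound_on_square) auto
  then have "d_one W U < e"
    using d_one_triangle[OF \<open>graphon W\<close> G U] GU by linarith
  then show ?thesis
    using that rs by blast
qed

section \<open>Searching for close step graphons\<close>

lemma d_one_cong: "(\<And>z. z \<in> unit_square \<Longrightarrow> W z = W' z) \<Longrightarrow> d_one W U = d_one W' U"
  unfolding d_one_eq by (intro Bochner_Integration.integral_cong) (auto simp: space_square_measure)

text \<open>Rounding down each of the \<open>R * R\<close> terms, scaled by \<open>D\<close>, loses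
  at most 1 per term, so the integer sum lies within \<open>R * R\<close> below
  \<open>D * Q * R^2\<close>. One comparison of natural numbers thus certifies
  \<open>Q \<le> 2 / D\<close> and is sure to succeed if \<open>Q \<le> 1 / D\<close>.\<close>

lemma average_floor_test:
  fixes p q :: "nat \<Rightarrow> nat \<Rightarrow> nat"
  assumes R: "R > 0" and D: "D > 0" and q: "\<And>i j. i < R \<Longrightarrow> j < R \<Longrightarrow> q i j > 0"
    and Q: "Q = (\<Sum>i<R. \<Sum>j<R. real (p i j) / real (q i j)) / (real R)\<^sup>2"
  shows "(\<Sum>i<R. \<Sum>j<R. D * p i j div q i j) \<le> R * R \<Longrightarrow> Q \<le> 2 / real D"
    and "Q \<le> 1 / real D \<Longrightarrow> (\<Sum>i<R. \<Sum>j<R. D * p i j div q i j) \<le> R * R"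
proof -
  let ?S = "\<Sum>i<R. \<Sum>j<R. D * p i j div q i j"
  have DQ: "real D * Q * (real R)\<^sup>2 = (\<Sum>i<R. \<Sum>j<R. real (D * p i j) / real (q i j))"
    using R by (simp add: Q sum_distrib_left)
  have floor: "real (D * p i j div q i j) = of_int \<lfloor>real (D * p i j) / real (q i j)\<rfloor>" for i j
    by (metis floor_divide_of_nat_eq of_int_of_nat_eq)
  have "real ?S \<le> real D * Q * (real R)\<^sup>2"
    unfolding DQ of_nat_sum floor by (intro sum_mono) simp
  moreover have "real D * Q * (real R)\<^sup>2 \<le> (\<Sum>i<R. \<Sum>j<R. real (D * p i j div q i j) + 1)"
    unfolding DQ floor by (intro sum_mono) linarith
  then have "real D * Q * (real R)\<^sup>2 \<le> real ?S + (real R)\<^sup>2"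
    by (simp add: sum.distrib power2_eq_square)
  moreover have R2: "(real R)\<^sup>2 > 0" "real (R * R) = (real R)\<^sup>2"
    using R by (simp_all add: power2_eq_square)
  moreover have "real D > 0"
    using D by simp
  ultimately have lo: "real ?S \<le> real D * Q * (real R)\<^sup>2" and hi: "real D * Q * (real R)\<^sup>2 \<le> real ?S + (real R)\<^sup>2"
    by blast+
  show "Q \<le> 2 / real D" if S: "?S \<le> R * R"
  proof -
    have "real ?S \<le> real (R * R)"
      using S by (simp only: of_nat_le_iff)
    then have "(real D * Q) * (real R)\<^sup>2 \<le> 2 * (real R)\<^sup>2"
      using hi R2(2) by linarith
    then have "real D * Q \<le> 2"
      using R2(1) by (simp only: mult_le_cancel_right_pos)
    then show ?thesis
      using D by (simp add: field_simps)
  qed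
  show "?S \<le> R * R" if "Q \<le> 1 / real D"
  proof -
    have "real D * Q \<le> 1"
      using that D by (simp add: field_simps)
    then have "(real D * Q) * (real R)\<^sup>2 \<le> 1 * (real R)\<^sup>2"
      by (rule mult_right_mono) simp
    then have "real ?S \<le> real (R * R)"
      using lo R2(2) by linarith
    then show ?thesis
      by (simp only: of_nat_le_iff)
  qed
qed

theorem theorem4p6:
  fixes U :: "real \<times> real \<Rightarrow> real" and s :: "nat \<Rightarrow> real \<times> real \<Rightarrow> real"
  assumes "computable_enumeration s"
    and "graphon U"
    and "random_free U"
    and "computable_in d_cut s U"
  shows "computable_in d_one s U"
proof -
  note U = assms(2) and rf = assms(3)
  from assms(1) have rs: "\<And>m. rational_step_graphon (s m)"
    and surj: "\<And>W. rational_step_graphon W \<Longrightarrow> \<exists>m. \<forall>z\<in>unit_square. s m z = W z"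
    by (auto simp: computable_enumeration_def)
  from assms(1) obtain n a b where nab: "computable n" "computable3 a" "computable3 b"
    and enum: "\<forall>m. n m > 0 \<and> (\<forall>i < n m. \<forall>j < n m. b m i j > 0 \<and>
      (\<forall>z \<in> part (n m) i \<times> part (n m) j. s m z = real (a m i j) / real (b m i j)))"
    unfolding computable_enumeration_def by (elim conjE exE)
  have n: "n m > 0" for m
    using enum by simp
  have b: "b m i j > 0" if "i < n m" "j < n m" for m i j
    using enum that by simp
  have val: "s m z = real (a m i j) / real (b m i j)"
    if "i < n m" "j < n m" "z \<in> block (n m) i j" for m i j z
    using enum[THEN spec, of m] that unfolding block_def by blast
  from assms(4) obtain k where k: "computable k"
    and cauchy: "\<And>j l. j < l \<Longrightarrow> d_cut (s (k j)) (s (k l)) \<le> 1 / 2 ^ j"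
    and lim: "(\<lambda>j. d_cut (s (k j)) U) \<longlonglongrightarrow> 0"
    unfolding computable_in_def is_name_def by blast
  have s: "graphon (s m)" for m
    using rs unfolding rational_step_graphon_def by blast
  \<comment> \<open>This makes the natural-number subtractions \<open>b - a\<close> in the numerator
    \<open>p\<close> below exact.\<close>
  have ab: "a m i j \<le> b m i j" if ij: "i < n m" "j < n m" for m i j
  proof -
    obtain z where z: "z \<in> block (n m) i j"
      using block_nonempty[OF ij] .
    then have "s m z \<le> 1"
      using graphon_bounds[OF s] block_subset[OF ij] by blast
    then show ?thesis
      using val[OF ij z] b[OF ij] by simp
  qed

  \<comment> \<open>With this precision the replacement of \<open>U\<close> by \<open>s (v j m)\<close> costs at most \<open>1 / 2 ^ (j + 4)\<close>.\<close>
  define v where "v j m = k (j + 4 + n m * n m)" for j m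
  \<comment> \<open>The common refinement of the grids of \<open>s m\<close> and
    \<open>s (v j m)\<close>: dividing a fine index by the number of parts of one grid gives the
    index in the other.\<close>
  define R where "R j m = n m * n (v j m)" for j m
  \<comment> \<open>\<open>p / q\<close> is the value of \<open>W * (1 - V) + V * (1 - W)\<close> on
    a fine block, over the product of the two denominators, for \<open>W = s m\<close> and
    \<open>V = s (v j m)\<close>.\<close>
  define p where "p j m i i' =
      a m (i div n (v j m)) (i' div n (v j m)) *
        (b (v j m) (i div n m) (i' div n m) - a (v j m) (i div n m) (i' div n m)) +
      a (v j m) (i div n m) (i' div n m) *
        (b m (i div n (v j m)) (i' div n (v j m)) - a m (i div n (v j m)) (i' div n (v j m)))"
    for j m i i'
  define q where "q j m i i' =
      b m (i div n (v j m)) (i' div n (v j m)) * b (v j m) (i div n m) (i' div n m)" for j m i i'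
  \<comment> \<open>By truncated subtraction, \<open>test j m = 0\<close> is the comparison of
    \<open>average_floor_test\<close> with \<open>D = 2 ^ (j + 3)\<close>, in the form that
    minimisation needs.\<close>
  define test where "test j m =
      (\<Sum>i<R j m. \<Sum>i'<R j m. 2 ^ (j + 3) * p j m i i' div q j m i i') - R j m * R j m" for j m

  have R: "R j m > 0" for j m
    using n by (simp add: R_def)
  \<comment> \<open>Passing the test gives \<open>Q \<le> 2^-j / 4\<close>, and \<open>Q\<close>
    differs from the true distance by at most \<open>2^-j / 16\<close>, so the distance is below
    \<open>2^-j / 2\<close>. Conversely, a distance below \<open>2^-j / 16\<close> forces
    \<open>Q \<le> 2^-j / 8 = 1 / D\<close>.\<close>
  have test: "test j m = 0 \<Longrightarrow> d_one (s m) U \<le> 1 / 2 ^ j / 2"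
    and test_close: "d_one (s m) U < 1 / 2 ^ (j + 4) \<Longrightarrow> test j m = 0" for j m
  proof -
    let ?W = "s m" and ?V = "s (v j m)"
    define Q where "Q = (LINT z|square_measure. ?W z * (1 - ?V z) + ?V z * (1 - ?W z))"
    have idx: "i div n (v j m) < n m" "i div n m < n (v j m)" if "i < R j m" for i
      using that by (simp_all add: R_def less_mult_imp_div_less mult.commute)
    have q: "q j m i i' > 0" if "i < R j m" "i' < R j m" for i i'
      using b idx that by (simp add: q_def)
    have step: "?W z * (1 - ?V z) + ?V z * (1 - ?W z) = real (p j m i i') / real (q j m i i')"
      if "i < R j m" "i' < R j m" "z \<in> block (R j m) i i'" for i i' z
    proof -
      note I = idx[OF that(1)] idx[OF that(2)]
      have W: "?W z = real (a m (i div n (v j m)) (i' div n (v j m))) / real (b m (i div n (v j m)) (i' div n (v j m)))"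
        using that I unfolding R_def by (intro val block_refine)
      have V: "?V z = real (a (v j m) (i div n m) (i' div n m)) / real (b (v j m) (i div n m) (i' div n m))"
        using that I unfolding R_def by (intro val block_refine) (simp_all add: mult.commute)
      show ?thesis
        unfolding W V p_def q_def using ab[OF I(1,3)] ab[OF I(2,4)] b[OF I(1,3)] b[OF I(2,4)]
        by (simp add: of_nat_diff field_simps)
    qed
    have Q: "Q = (\<Sum>i<R j m. \<Sum>i'<R j m. real (p j m i i') / real (q j m i i')) / (real (R j m))\<^sup>2"
      unfolding Q_def using step by (intro integral_step R)
    have "\<bar>Q - d_one ?W U\<bar> \<le> (real (n m))\<^sup>2 * (1 / 2 ^ (j + 4 + n m * n m))"
      unfolding Q_def
    proof (rule d_one_approx[OF s s U rf n val])
      fix i i' assume "i < n m" "i' < n m"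
      then show "\<bar>LINT z|square_measure. indicator (block (n m) i i') z * (?V z - U z)\<bar> \<le> 1 / 2 ^ (j + 4 + n m * n m)"
        unfolding v_def by (intro block_integral_limit[where V = "\<lambda>j. s (k j)"] s U cauchy lim)
    qed
    \<comment> \<open>The summand \<open>n m * n m\<close> in the index of \<open>v\<close> absorbs
      the number of blocks, since \<open>x \<le> 2 ^ x\<close>.\<close>
    also have "\<dots> = real (n m * n m) / 2 ^ (n m * n m) * (1 / 2 ^ (j + 4))"
      by (simp add: power_add power2_eq_square)
    also have "\<dots> \<le> 1 * (1 / 2 ^ (j + 4))"
      using of_nat_less_two_power[of "n m * n m", where 'a = real]
      by (intro mult_right_mono) (simp_all add: less_imp_le)
    finally have close: "\<bar>Q - d_one ?W U\<bar> \<le> 1 / 2 ^ (j + 4)"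
      by simp
    have pow: "1 / 2 ^ (j + 4) = 1 / 2 ^ j / (16::real)" "real (2 ^ (j + 3)) = 2 ^ j * 8"
      by (simp_all add: power_add)
    note floor_test = average_floor_test[OF R _ q Q, of "2 ^ (j + 3)"]
    show "d_one (s m) U \<le> 1 / 2 ^ j / 2" if "test j m = 0"
    proof -
      have "Q \<le> 2 / real (2 ^ (j + 3))"
        using that by (intro floor_test(1)) (auto simp: test_def)
      then have "Q \<le> 1 / 2 ^ j / 4"
        unfolding pow by simp
      then show ?thesis
        using close zero_le_power[of 2 j] unfolding pow by (simp add: abs_le_iff field_simps)
    qed
    show "test j m = 0" if "d_one (s m) U < 1 / 2 ^ (j + 4)"
    proof -
      have "Q \<le> 1 / 2 ^ j / 8"
        using close that unfolding pow by linarith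
      then have "Q \<le> 1 / real (2 ^ (j + 3))"
        unfolding pow by simp
      then show ?thesis
        unfolding test_def using floor_test(2) by simp
    qed
  qed

  \<comment> \<open>Density makes the search total. The enumeration reproduces the approximant only
    on the unit square, which is all that \<open>d_one\<close> sees.\<close>
  have ex: "\<exists>m. test j m = 0" for j
  proof -
    obtain W where "rational_step_graphon W" and W: "d_one W U < 1 / 2 ^ (j + 4)"
      using rational_step_graphon_dense[OF U, of "1 / 2 ^ (j + 4)"] by auto
    then obtain m where sm: "\<forall>z\<in>unit_square. s m z = W z"
      using surj by blast
    then have "d_one (s m) U < 1 / 2 ^ (j + 4)"
      using W d_one_cong[of "s m" W U, OF bspec[OF sm]] by simp
    then show ?thesis
      using test_close by blast
  qed

  define h where "h j = (LEAST m. test j m = 0)" for j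
  have h: "d_one (s (h j)) U \<le> 1 / 2 ^ j / 2" for j
    unfolding h_def by (rule test[OF LeastI_ex[OF ex]])

  have "computable h"
    unfolding computable_iff_recursive_fn h_def
  proof (rule recursive_fn_Least)
    note comps = recursive_fn_comp1[OF nab(1)[unfolded computable_iff_recursive_fn]]
      recursive_fn_comp1[OF k[unfolded computable_iff_recursive_fn]]
      recursive_fn_comp3[OF computable3_imp_recursive_fn[OF nab(2)]]
      recursive_fn_comp3[OF computable3_imp_recursive_fn[OF nab(3)]]
    \<comment> \<open>The search candidate \<open>m\<close> is prepended to the environment, so
      \<open>j\<close> moves to position 1.\<close>
    show "recursive_fn (Suc 1) (\<lambda>xs. test (tl xs ! 0) (xs ! 0))"
      unfolding test_def R_def p_def q_def v_def
      by (intro recursive_intros comps) simp_all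
  qed (rule ex)
  moreover have "is_name d_one s U h"
    unfolding is_name_def
  proof (intro conjI allI impI)
    fix j l :: nat assume "j < l"
    then have "1 / 2 ^ l / 2 \<le> 1 / 2 ^ j / (2::real)"
      by (simp add: frac_le)
    \<comment> \<open>The spare factor 1/2 in \<open>h\<close> pays for this detour through
      \<open>U\<close>: the two distances add up to at most \<open>1 / 2 ^ j\<close>.\<close>
    moreover have "d_one (s (h j)) (s (h l)) \<le> d_one (s (h j)) U + d_one (s (h l)) U"
      using d_one_triangle[OF s U s] d_one_commute by metis
    ultimately show "d_one (s (h j)) (s (h l)) \<le> 1 / 2 ^ j"
      using h[of j] h[of l] by linarith
  next
    show "(\<lambda>j. d_one (s (h j)) U) \<longlonglongrightarrow> 0"
    proof (rule real_tendsto_sandwich[where f = "\<lambda>_. 0" and h = "\<lambda>j. 1 / 2 ^ j / 2"])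
      show "(\<lambda>j. 1 / 2 ^ j / 2) \<longlonglongrightarrow> (0::real)"
        using tendsto_divide[OF LIMSEQ_inverse_realpow_zero[of 2] tendsto_const[of 2]]
        by (simp add: inverse_eq_divide)
    qed (simp_all only: h d_one_nonneg eventually_True tendsto_const)
  qed
  ultimately show ?thesis
    unfolding computable_in_def by blast
qed

end
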